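(* Let $\mathscr{B}$ be a real Banach space, let $\mathscr{C}$ be a nonempty, bounded, closed and convex subset of $\mathscr{B}$, and let $\mu$ be an arbitrary measure of noncompactness in $\mathscr{B}$. Let $Q\in\mathcal{Q}$, $\delta\in\Delta$, $\mathscr{E}\in\mathbb{E}$, and let $F:\mathbb{R}_+\to\mathbb{R}_+$ be a non-decreasing continuous function. Assume in addition that $Q(a+b)\le Q(a)+Q(b)$ and $F(a+b)\le F(a)+F(b)$ for all $a,b\ge0$. Let $\Psi:\mathscr{C}\times\mathscr{C}\to\mathscr{C}$ be a continuous operator such that $$Q\left[\mathscr{E}\left\{\mu(\Psi(s_1\times s_2)),F(\mu(\Psi(s_1\times s_2)))\right\}\right]\le\frac12\,\delta\Big[Q\big[\mathscr{E}\{\mu(s_1),F(\mu(s_1))\}+\mathscr{E}\{\mu(s_2),F(\mu(s_2))\}\big]\Big]$$ for all nonempty $s_1,s_2\subseteq\mathscr{C}$. Then $\Psi$ has at least one coupled fixed point in $\mathscr{C}$, i.e. there is $(u,v)\in\mathscr{C}\times\mathscr{C}$ with $\Psi(u,v)=u$ and $\Psi(v,u)=v$.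
   Context: $\mathbb{R}_+=[0,\infty)$. For a Banach space $\mathscr{B}$, $\mathfrak{M}_{\mathscr{B}}$ denotes the collection of all nonempty bounded subsets of $\mathscr{B}$, $\mathfrak{N}_{\mathscr{B}}$ the collection of all relatively compact sets, $\bar{\mathscr{K}}$ the closure and $\mathrm{Conv}\,\mathscr{K}$ the convex closure (closed convex hull) of $\mathscr{K}$. A mapping $\mu:\mathfrak{M}_{\mathscr{B}}\to[0,\infty)$ is a measure of noncompactness in $\mathscr{B}$ if: (i) for all $\mathscr{K}\in\mathfrak{M}_{\mathscr{B}}$, $\mu(\mathscr{K})=0$ implies $\mathscr{K}$ is relatively compact; (ii) $\ker\mu=\{\mathscr{K}\in\mathfrak{M}_{\mathscr{B}}:\mu(\mathscr{K})=0\}\neq\emptyset$ and $\ker\mu\subset\mathfrak{N}_{\mathscr{B}}$; (iii) $\mathscr{K}\subseteq\mathscr{K}_1\implies\mu(\mathscr{K})\le\mu(\mathscr{K}_1)$; (iv) $\mu(\bar{\mathscr{K}})=\mu(\mathscr{K})$; (v) $\mu(\mathrm{Conv}\,\mathscr{K})=\mu(\mathscr{K})$; (vi) $\mu(\varpi\mathscr{K}+(1-\varpi)\mathscr{K}_1)\le\varpi\mu(\mathscr{K})+(1-\varpi)\mu(\mathscr{K}_1)$ for $\varpi\in[0,1)$; (vii) if $\mathscr{K}_q\in\mathfrak{M}_{\mathscr{B}}$, $\mathscr{K}_q=\bar{\mathscr{K}}_q$, $\mathscr{K}_{q+1}\subset\mathscr{K}_q$ for $q=1,2,\dots$ and $\lim_{q\to\infty}\mu(\mathscr{K}_q)=0$,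 then $\bigcap_{q=1}^\infty\mathscr{K}_q\neq\emptyset$. $\mathcal{Q}$ is the class of all $Q:\mathbb{R}_+\to\mathbb{R}$ such that: (a) $Q$ is non-decreasing; (b) $Q$ is continuous; (c) for each sequence $\{t_k\}\subset(0,\infty)$, $\lim_{k\to\infty}Q(t_k)=0\Leftrightarrow\lim_{k\to\infty}t_k=0$ (that is, $Q(t)=0$ iff $t=0$). $\Delta$ is the family of all functions $\delta:\mathbb{R}_+\to\mathbb{R}_+$ such that: (a) $\delta$ is monotone increasing; (b) $\lim_{q\to\infty}\delta^q(z)=0$ for all $z>0$, where $\delta^q$ is the $q$-fold iterate. $\mathbb{E}$ is the class of all $\mathscr{E}:\mathbb{R}_+\times\mathbb{R}_+\to\mathbb{R}$ such that: (a) $\mathscr{E}(z_1,z_2)\ge\max\{z_1,z_2\}$ for $z_1,z_2\ge0$; (b) $\mathscr{E}$ is continuous; (c) $\mathscr{E}(z_1+z_2,x_1+x_2)\le\mathscr{E}(z_1,x_1)+\mathscr{E}(z_2,x_2)$. *)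

theory Defs
  imports "HOL-Analysis.Analysis"
begin

text \<open>
  Functions with domain \<open>[0, \<infinity>)\<close> are total functions on the reals of which only the values on
  \<open>{0..}\<close> are constrained. Likewise a measure of noncompactness is a total function on sets, constrained
  only on the nonempty bounded ones.
\<close>

definition bounded_sets :: "'a::real_normed_vector set set" where
  "bounded_sets = {K. K \<noteq> {} \<and> bounded K}"

definition relatively_compact :: "'a::topological_space set \<Rightarrow> bool" where
  "relatively_compact K \<longleftrightarrow> compact (closure K)"

definition mnc_kernel :: "('a::real_normed_vector set \<Rightarrow> real) \<Rightarrow> 'a set set" where
  "mnc_kernel \<mu> = {K \<in> bounded_sets. \<mu> K = 0}"

definition measure_of_noncompactness :: "('a::real_normed_vector set \<Rightarrow> real) \<Rightarrow> bool" where
  "measure_of_noncompactness \<mu> \<longleftrightarrow>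
     (\<forall>K\<in>bounded_sets. 0 \<le> \<mu> K) \<and>
     (\<forall>K\<in>bounded_sets. \<mu> K = 0 \<longrightarrow> relatively_compact K) \<and>
     (mnc_kernel \<mu> \<noteq> {} \<and> mnc_kernel \<mu> \<subseteq> {K. relatively_compact K}) \<and>
     (\<forall>K\<in>bounded_sets. \<forall>K1\<in>bounded_sets. K \<subseteq> K1 \<longrightarrow> \<mu> K \<le> \<mu> K1) \<and>
     (\<forall>K\<in>bounded_sets. \<mu> (closure K) = \<mu> K) \<and>
     (\<forall>K\<in>bounded_sets. \<mu> (closure (convex hull K)) = \<mu> K) \<and>
     (\<forall>K\<in>bounded_sets. \<forall>K1\<in>bounded_sets. \<forall>w. 0 \<le> w \<and> w < 1 \<longrightarrow>
        \<mu> {w *\<^sub>R x + (1 - w) *\<^sub>R y | x y. x \<in> K \<and> y \<in> K1} \<le> w * \<mu> K + (1 - w) * \<mu> K1) \<and>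
     (\<forall>K :: nat \<Rightarrow> 'a set.
        (\<forall>q. K q \<in> bounded_sets \<and> K q = closure (K q) \<and> K (Suc q) \<subseteq> K q) \<longrightarrow>
        (\<lambda>q. \<mu> (K q)) \<longlonglongrightarrow> 0 \<longrightarrow> (\<Inter>q. K q) \<noteq> {})"

definition class_Q :: "(real \<Rightarrow> real) set" where
  "class_Q = {Q. mono_on {0..} Q \<and> continuous_on {0..} Q \<and>
     (\<forall>t :: nat \<Rightarrow> real. (\<forall>k. 0 < t k) \<longrightarrow> ((\<lambda>k. Q (t k)) \<longlonglongrightarrow> 0 \<longleftrightarrow> t \<longlonglongrightarrow> 0))}"

text \<open>
  ``Monotone increasing'' is read in the weak sense, which includes the strictly increasing
  functions.
\<close>

definition class_Delta :: "(real \<Rightarrow> real) set" where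
  "class_Delta = {\<delta>. \<delta> \<in> {0..} \<rightarrow> {0..} \<and> mono_on {0..} \<delta> \<and>
     (\<forall>z>0. (\<lambda>q. (\<delta> ^^ q) z) \<longlonglongrightarrow> 0)}"

definition class_E :: "(real \<times> real \<Rightarrow> real) set" where
  "class_E = {E. (\<forall>z1\<ge>0. \<forall>z2\<ge>0. max z1 z2 \<le> E (z1, z2)) \<and>
     continuous_on ({0..} \<times> {0..}) E \<and>
     (\<forall>z1\<ge>0. \<forall>z2\<ge>0. \<forall>x1\<ge>0. \<forall>x2\<ge>0.
        E (z1 + z2, x1 + x2) \<le> E (z1, x1) + E (z2, x2))}"

end

theory Submission
  imports Defs
begin

text \<open>
  Starting from \<open>C\<close>, iterate \<open>X \<mapsto> closure (convex hull (\<Psi> ` (X \<times> X)))\<close>. With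
  \<open>e n = E (\<mu> (X n), F (\<mu> (X n)))\<close>, subadditivity of \<open>Q\<close> turns the contraction condition into
  \<open>2 * Q (e (Suc n)) \<le> \<delta> (2 * Q (e n))\<close>, so \<open>e n\<close>, and with it \<open>\<mu> (X n)\<close>, tends to \<open>0\<close>. The intersection of
  the \<open>X n\<close> is then a nonempty compact convex set \<open>K\<close> with \<open>\<Psi> ` (K \<times> K) \<subseteq> K\<close>, and a coupled fixed point
  is a fixed point of \<open>(u, v) \<mapsto> (\<Psi> (u, v), \<Psi> (v, u))\<close> on \<open>K \<times> K\<close>, given by Schauder's theorem.

  Schauder's theorem needs Brouwer's in every finite dimension \<open>n\<close>, with \<open>n\<close> chosen inside the
  proof, whereas the library version has its dimension fixed by a type. It is replaced by the
  fixed point property of the cube with countably many coordinates, obtained from Kuhn's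
  combinatorial lemma.
\<close>

section \<open>Brouwer's theorem for the cube with countably many coordinates\<close>

abbreviation unit_cube :: "('i \<Rightarrow> real) set" where
  "unit_cube \<equiv> UNIV \<rightarrow> {0..1}"

lemma compact_unit_cube: "compact (unit_cube :: ('i \<Rightarrow> real) set)"
proof -
  have "compactin (product_topology (\<lambda>_. euclidean) UNIV) (PiE UNIV (\<lambda>_::'i. {0..1::real}))"
    unfolding compactin_PiE by simp
  then show ?thesis
    by (simp add: euclidean_product_topology PiE_UNIV_domain Pi_def)
qed

lemma tendsto_fun_iff:
  fixes f :: "'c \<Rightarrow> 'a \<Rightarrow> 'b::topological_space"
  shows "(f \<longlongrightarrow> l) G \<longleftrightarrow> (\<forall>i. ((\<lambda>x. f x i) \<longlongrightarrow> l i) G)"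
  using limitin_componentwise[of "\<lambda>_. euclidean" UNIV f l G]
  by (simp add: euclidean_product_topology)

text \<open>Kuhn's lemma is applied to the grid of mesh \<open>1 / n\<close> in the first
  \<open>n\<close> coordinates, the others being 0. A label change in coordinate \<open>i\<close>
  between two vertices of a cell gives one vertex where \<open>T\<close> does not lower that
  coordinate and one where it does not raise it. As \<open>n\<close> is both dimension and fineness,
  a single limit will handle all coordinates.\<close>

lemma approximate_fixed_point_unit_cube:
  fixes T :: "(nat \<Rightarrow> real) \<Rightarrow> nat \<Rightarrow> real"
  assumes T: "T \<in> unit_cube \<rightarrow> unit_cube" and n: "0 < n"
  shows "\<exists>q\<in>unit_cube. \<forall>i<n. \<exists>r\<in>unit_cube. \<exists>s\<in>unit_cube.
    (\<forall>j. \<bar>r j - q j\<bar> \<le> 1 / real n) \<and> (\<forall>j. \<bar>s j - q j\<bar> \<le> 1 / real n) \<and> r i \<le> T r i \<and> T s i \<le> s i"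
proof -
  \<comment> \<open>\<open>min 1\<close> keeps \<open>P x\<close> in the cube for every
    \<open>x\<close>, also off the grid.\<close>
  define P where "P x = (\<lambda>j. if j < n then min 1 (real (x j) / real n) else 0)" for x :: "nat \<Rightarrow> nat"
  \<comment> \<open>Kuhn's lemma prescribes the labels on the two boundary faces; they agree with
    the meaning of the other labels because \<open>T\<close> maps into the cube.\<close>
  define label where "label x i = (if x i = 0 then 0 else if x i = n then 1
      else if P x i \<le> T (P x) i then 0 else 1 :: nat)" for x i
  have P: "P x \<in> unit_cube" for x
    using n by (auto simp: P_def)
  have TP: "0 \<le> T (P x) i" "T (P x) i \<le> 1" for x i
    using T P[of x] by (auto simp: Pi_iff)
  have l0: "P x i \<le> T (P x) i" if "label x i = 0" "i < n" for x i
    using that TP[of x i] by (auto simp: label_def P_def split: if_splits)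
  have l1: "T (P x) i \<le> P x i" if "label x i \<noteq> 0" "i < n" for x i
    using that TP[of x i] n by (auto simp: label_def P_def split: if_splits)
  obtain q where q: "\<forall>i<n. q i < n"
    and rs: "\<forall>i<n. \<exists>r s. (\<forall>j<n. q j \<le> r j \<and> r j \<le> q j + 1) \<and>
      (\<forall>j<n. q j \<le> s j \<and> s j \<le> q j + 1) \<and> label r i \<noteq> label s i"
    by (rule kuhn_lemma[of n n label]) (use n in \<open>auto simp: label_def\<close>)
  have near: "\<bar>P r j - P q j\<bar> \<le> 1 / real n" if r: "\<forall>j<n. q j \<le> r j \<and> r j \<le> q j + 1" for r j
  proof (cases "j < n")
    case True
    then have "q j < n" "q j \<le> r j" "r j \<le> q j + 1"
      using q r by auto
    then have "real (r j) - real (q j) \<le> 1" "real (q j) \<le> real (r j)" "real (r j) \<le> real n"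
      by linarith+
    then show ?thesis
      using n True by (simp add: P_def flip: diff_divide_distrib) (simp add: divide_right_mono)
  next
    case False
    then show ?thesis by (simp add: P_def)
  qed
  show ?thesis
  proof (rule bexI[of _ "P q"], intro allI impI)
    fix i assume i: "i < n"
    then obtain r s where r: "\<forall>j<n. q j \<le> r j \<and> r j \<le> q j + 1"
      and s: "\<forall>j<n. q j \<le> s j \<and> s j \<le> q j + 1" and ne: "label r i \<noteq> label s i"
      using rs by blast
    show "\<exists>r\<in>unit_cube. \<exists>s\<in>unit_cube. (\<forall>j. \<bar>r j - P q j\<bar> \<le> 1 / real n) \<and>
      (\<forall>j. \<bar>s j - P q j\<bar> \<le> 1 / real n) \<and> r i \<le> T r i \<and> T s i \<le> s i"
    proof (cases "label r i = 0")
      case True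
      with ne show ?thesis
        using near[OF r] near[OF s] l0[of r i] l1[of s i] i P by (intro bexI[of _ "P r"] bexI[of _ "P s"]) auto
    next
      case False
      with ne have "label s i = 0"
        by (auto simp: label_def split: if_splits)
      with False show ?thesis
        using near[OF r] near[OF s] l0[of s i] l1[of r i] i P by (intro bexI[of _ "P s"] bexI[of _ "P r"]) auto
    qed
  qed (fact P)
qed

text \<open>By compactness a subsequence of the approximate points \<open>q\<close> converges to
  some \<open>x\<close>. For fixed \<open>i\<close> the witnesses \<open>r\<close> and
  \<open>s\<close> converge to the same \<open>x\<close>, so both inequalities pass to the limit in
  coordinate \<open>i\<close>.\<close>

theorem brouwer_unit_cube:
  fixes T :: "(nat \<Rightarrow> real) \<Rightarrow> nat \<Rightarrow> real"
  assumes T: "T \<in> unit_cube \<rightarrow> unit_cube" and cont: "continuous_on unit_cube T"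
  obtains x where "x \<in> unit_cube" "T x = x"
proof -
  have "\<forall>n. \<exists>q\<in>unit_cube. \<forall>i<Suc n. \<exists>r\<in>unit_cube. \<exists>s\<in>unit_cube.
    (\<forall>j. \<bar>r j - q j\<bar> \<le> 1 / real (Suc n)) \<and> (\<forall>j. \<bar>s j - q j\<bar> \<le> 1 / real (Suc n)) \<and>
    r i \<le> T r i \<and> T s i \<le> s i"
    using approximate_fixed_point_unit_cube[OF T] by blast
  then obtain q where q: "\<And>n. q n \<in> unit_cube"
    and q': "\<And>n i. i < Suc n \<Longrightarrow> \<exists>r\<in>unit_cube. \<exists>s\<in>unit_cube.
      (\<forall>j. \<bar>r j - q n j\<bar> \<le> 1 / real (Suc n)) \<and> (\<forall>j. \<bar>s j - q n j\<bar> \<le> 1 / real (Suc n)) \<and>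
      r i \<le> T r i \<and> T s i \<le> s i"
    by metis
  obtain x \<sigma> where x: "x \<in> unit_cube" and \<sigma>: "strict_mono \<sigma>" and lim: "(q \<circ> \<sigma>) \<longlonglongrightarrow> x"
    using compact_unit_cube[where 'i = nat] q unfolding compact_def by blast
  have lim_near: "u \<longlonglongrightarrow> x \<and> (\<lambda>k. T (u k) i) \<longlonglongrightarrow> T x i"
    if u: "\<And>k. u k \<in> unit_cube"
      and near: "\<And>k j. i \<le> k \<Longrightarrow> \<bar>u k j - q (\<sigma> k) j\<bar> \<le> 1 / real (Suc (\<sigma> k))" for u i
  proof -
    have "(\<lambda>k. u k j) \<longlonglongrightarrow> x j" for j
    proof -
      have "(\<lambda>k. 1 / real (Suc (\<sigma> k))) \<longlonglongrightarrow> 0"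
        using LIMSEQ_subseq_LIMSEQ[OF LIMSEQ_Suc[OF lim_1_over_n] \<sigma>] by (simp add: o_def)
      then have "(\<lambda>k. u k j - q (\<sigma> k) j) \<longlonglongrightarrow> 0"
        by (rule Lim_null_comparison[rotated])
          (use near in \<open>auto simp: eventually_sequentially simp del: of_nat_Suc\<close>)
      moreover have "(\<lambda>k. q (\<sigma> k) j) \<longlonglongrightarrow> x j"
        using lim by (simp add: tendsto_fun_iff o_def)
      ultimately show ?thesis
        using tendsto_add by fastforce
    qed
    then have "u \<longlonglongrightarrow> x"
      by (simp add: tendsto_fun_iff)
    moreover from this have "(\<lambda>k. T (u k)) \<longlonglongrightarrow> T x"
      by (rule continuous_on_tendsto_compose[OF cont _ x]) (simp add: u)
    ultimately show ?thesis
      by (simp add: tendsto_fun_iff)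
  qed
  have "T x i = x i" for i
  proof (rule antisym)
    \<comment> \<open>Witnesses for \<open>i\<close> are available once
      \<open>i \<le> k \<le> \<sigma> k\<close>. For smaller \<open>k\<close> any point of the cube
      will do, which lets \<open>r\<close> and \<open>s\<close> be chosen as total
      sequences.\<close>
    have "\<exists>r\<in>unit_cube. \<exists>s\<in>unit_cube. i \<le> k \<longrightarrow> (\<forall>j. \<bar>r j - q (\<sigma> k) j\<bar> \<le> 1 / real (Suc (\<sigma> k))) \<and>
      (\<forall>j. \<bar>s j - q (\<sigma> k) j\<bar> \<le> 1 / real (Suc (\<sigma> k))) \<and> r i \<le> T r i \<and> T s i \<le> s i" for k
      using q'[of i "\<sigma> k"] x seq_suble[OF \<sigma>, of k] by (cases "i \<le> k") auto
    then obtain r s where r: "\<And>k. r k \<in> unit_cube" and s: "\<And>k. s k \<in> unit_cube"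
      and rs: "\<And>k. i \<le> k \<Longrightarrow> (\<forall>j. \<bar>r k j - q (\<sigma> k) j\<bar> \<le> 1 / real (Suc (\<sigma> k))) \<and>
      (\<forall>j. \<bar>s k j - q (\<sigma> k) j\<bar> \<le> 1 / real (Suc (\<sigma> k))) \<and> r k i \<le> T (r k) i \<and> T (s k) i \<le> s k i"
      by metis
    have r': "r \<longlonglongrightarrow> x \<and> (\<lambda>k. T (r k) i) \<longlonglongrightarrow> T x i" and s': "s \<longlonglongrightarrow> x \<and> (\<lambda>k. T (s k) i) \<longlonglongrightarrow> T x i"
      using r s rs by (auto intro!: lim_near)
    show "T x i \<le> x i"
      by (rule tendsto_le[of sequentially "\<lambda>k. s k i" _ "\<lambda>k. T (s k) i"])
        (use s' rs in \<open>auto simp: tendsto_fun_iff eventually_sequentially\<close>)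
    show "x i \<le> T x i"
      by (rule tendsto_le[of sequentially "\<lambda>k. T (r k) i" _ "\<lambda>k. r k i"])
        (use r' rs in \<open>auto simp: tendsto_fun_iff eventually_sequentially\<close>)
  qed
  then show thesis
    using x that by blast
qed

section \<open>Schauder's fixed point theorem\<close>

text \<open>Without a fixed point, compactness gives \<open>f\<close> a least displacement
  \<epsilon> > 0. A finite net of radius \<epsilon> yields a projection into the convex hull of the
  net that moves points of \<open>K\<close> by less than \<epsilon>. A fixed point of
  \<open>f\<close> followed by this projection is displaced by \<open>f\<close> by less than
  \<epsilon>, a contradiction.\<close>

theorem schauder:
  fixes f :: "'a::real_normed_vector \<Rightarrow> 'a"
  assumes K: "compact K" "convex K" "K \<noteq> {}" and cont: "continuous_on K f" and f: "f \<in> K \<rightarrow> K"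
  obtains x where "x \<in> K" "f x = x"
proof (rule ccontr)
  assume "\<not> thesis"
  with that have nofix: "f x \<noteq> x" if "x \<in> K" for x
    using \<open>x \<in> K\<close> by blast
  have "continuous_on K (\<lambda>x. norm (f x - x))"
    by (intro continuous_intros cont)
  then obtain z where z: "z \<in> K" and zmin: "\<And>x. x \<in> K \<Longrightarrow> norm (f z - z) \<le> norm (f x - x)"
    using continuous_attains_inf[OF K(1,3)] by blast
  define \<epsilon> where "\<epsilon> = norm (f z - z)"
  have \<epsilon>: "\<epsilon> > 0"
    using nofix[OF z] by (simp add: \<epsilon>_def)
  obtain N where N: "finite N" "N \<subseteq> K" "K \<subseteq> (\<Union>p\<in>N. ball p \<epsilon>)"
    using compactE_image[OF K(1), of K "\<lambda>p. ball p \<epsilon>"] \<epsilon> by force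
  then obtain c n where c: "bij_betw c {..<n::nat} N"
    using ex_bij_betw_nat_finite lessThan_atLeast0 by metis
  have n: "0 < n"
    using c N(3) K(3) by (cases n) (auto simp: bij_betw_def)
  have cK: "c i \<in> K" if "i < n" for i
    using that c N(2) by (auto simp: bij_betw_def)

  \<comment> \<open>Normalising the bumps gives weights \<open>w i\<close> that sum to 1 on
    \<open>K\<close> and vanish outside the ball about \<open>c i\<close>; they are the coefficients
    of the Schauder projection.\<close>
  define bump where "bump i y = max 0 (\<epsilon> - dist (c i) y)" for i y
  define B where "B y = (\<Sum>i<n. bump i y)" for y
  have bump_nonneg: "0 \<le> bump i y" for i y
    by (simp add: bump_def)
  have B_pos: "0 < B y" if "y \<in> K" for y
  proof -
    obtain i where "i < n" "dist (c i) y < \<epsilon>"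
      using N(3) \<open>y \<in> K\<close> c by (fastforce simp: bij_betw_def)
    then show ?thesis
      unfolding B_def by (intro sum_pos2[of _ i]) (auto simp: bump_def)
  qed
  define w where "w i y = bump i y / B y" for i y
  have w_nonneg: "0 \<le> w i y" if "y \<in> K" for i y
    using B_pos[OF that] bump_nonneg by (simp add: w_def)
  have w_sum: "(\<Sum>i<n. w i y) = 1" if "y \<in> K" for y
    using B_pos[OF that] by (simp add: w_def B_def flip: sum_divide_distrib)
  have w_le: "w i y \<le> 1" if "y \<in> K" "i < n" for i y
    using member_le_sum[of i "{..<n}" "\<lambda>i. w i y"] w_nonneg w_sum that by simp
  have w_cont: "continuous_on K (w i)" for i
    unfolding w_def bump_def B_def
    by (intro continuous_intros ballI) (use B_pos in \<open>force simp: B_def bump_def\<close>)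
  have w_near: "dist y (\<Sum>i<n. w i y *\<^sub>R c i) < \<epsilon>" if "y \<in> K" for y
  proof -
    \<comment> \<open>The centres with nonzero weight lie in the ball; the others are moved there at no cost.\<close>
    have "(\<Sum>i<n. w i y *\<^sub>R (if w i y = 0 then y else c i)) \<in> ball y \<epsilon>"
      using that \<epsilon> w_nonneg w_sum
      by (intro convex_sum) (auto simp: w_def bump_def dist_commute)
    also have "(\<Sum>i<n. w i y *\<^sub>R (if w i y = 0 then y else c i)) = (\<Sum>i<n. w i y *\<^sub>R c i)"
      by (rule sum.cong) auto
    finally show ?thesis by simp
  qed

  \<comment> \<open>\<open>l\<close> is a retraction of the \<open>n\<close>-dimensional cube onto the standard simplex.\<close>
  define S where "S t = (\<Sum>i<n. t i)" for t :: "nat \<Rightarrow> real"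
  define l where "l i t = (t i + max 0 (1 - S t) / n) / max 1 (S t)" for i t
  have l_nonneg: "0 \<le> l i t" if "t \<in> unit_cube" for i t
    using that by (auto simp: l_def Pi_iff intro!: divide_nonneg_nonneg add_nonneg_nonneg)
  have l_sum: "(\<Sum>i<n. l i t) = 1" for t
  proof -
    have "(\<Sum>i<n. l i t) = (S t + max 0 (1 - S t)) / max 1 (S t)"
      using n by (simp add: l_def S_def sum.distrib flip: sum_divide_distrib)
    then show ?thesis
      by (simp add: max_def)
  qed
  define y where "y t = (\<Sum>i<n. l i t *\<^sub>R c i)" for t
  have y: "y t \<in> K" if "t \<in> unit_cube" for t
    unfolding y_def using that K(2) cK l_nonneg l_sum by (intro convex_sum) auto
  have y_cont: "continuous_on unit_cube y"
    unfolding y_def l_def S_def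
    by (intro continuous_intros continuous_on_subset[OF continuous_on_product_coordinates]) (use n in auto)

  \<comment> \<open>\<open>T\<close> sends \<open>t\<close> to the weights of
    \<open>f (y t)\<close>; padding with 0 embeds the problem in dimension \<open>n\<close> into the
    countable cube.\<close>
  define T where "T t i = (if i < n then w i (f (y t)) else 0)" for t i
  have fy: "f (y t) \<in> K" if "t \<in> unit_cube" for t
    using y[OF that] f by auto
  have "T \<in> unit_cube \<rightarrow> unit_cube"
    using w_nonneg[OF fy] w_le[OF fy] by (fastforce simp: T_def)
  moreover have "continuous_on unit_cube T"
  proof (rule continuous_on_coordinatewise_then_product)
    fix i
    have "continuous_on unit_cube (\<lambda>t. w i (f (y t)))"
      by (rule continuous_on_compose2[OF w_cont continuous_on_compose2[OF cont y_cont]]) (use y fy in auto)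
    then show "continuous_on unit_cube (\<lambda>t. T t i)"
      by (cases "i < n") (simp_all add: T_def)
  qed
  ultimately obtain t where t: "t \<in> unit_cube" "T t = t"
    by (rule brouwer_unit_cube)
  have tw: "t i = w i (f (y t))" if "i < n" for i
    using fun_cong[OF t(2), of i] that by (simp add: T_def)
  \<comment> \<open>The fixed point \<open>t\<close> consists of weights, so it lies on the simplex,
    where \<open>l\<close> changes nothing.\<close>
  then have "S t = 1"
    using w_sum[OF fy[OF t(1)]] by (simp add: S_def)
  then have "y t = (\<Sum>i<n. w i (f (y t)) *\<^sub>R c i)"
    by (simp add: y_def l_def tw)
  then have "norm (f (y t) - y t) < \<epsilon>"
    using w_near[OF fy[OF t(1)]] by (simp add: dist_norm)
  then show False
    using zmin[OF y[OF t(1)]] by (simp add: \<epsilon>_def)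
qed


section \<open>Limits governed by the classes \<open>class_Q\<close> and
  \<open>class_Delta\<close>\<close>

text \<open>The sequence condition speaks of positive arguments; continuity along
  \<open>1 / (k + 1)\<close> carries it to 0.\<close>

lemma class_Q_zero: "Q \<in> class_Q \<Longrightarrow> Q 0 = 0"
proof -
  assume "Q \<in> class_Q"
  then have cont: "continuous_on {0..} Q"
    and null: "\<And>t. (\<And>k::nat. 0 < t k) \<Longrightarrow> (\<lambda>k. Q (t k)) \<longlonglongrightarrow> 0 \<longleftrightarrow> t \<longlonglongrightarrow> 0"
    by (auto simp: class_Q_def)
  have lim: "(\<lambda>k. inverse (real (Suc k))) \<longlonglongrightarrow> 0"
    by (rule LIMSEQ_inverse_real_of_nat)
  then have "(\<lambda>k. Q (inverse (real (Suc k)))) \<longlonglongrightarrow> Q 0"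
    by (rule continuous_on_tendsto_compose[OF cont]) auto
  moreover have "(\<lambda>k. Q (inverse (real (Suc k)))) \<longlonglongrightarrow> 0"
    using lim by (subst null) auto
  ultimately show "Q 0 = 0"
    by (rule LIMSEQ_unique)
qed

lemma class_Q_nonneg: "Q \<in> class_Q \<Longrightarrow> 0 \<le> t \<Longrightarrow> 0 \<le> Q t"
  using class_Q_zero[of Q] mono_onD[of "{0..}" Q 0 t] by (simp add: class_Q_def)

lemma class_Q_pos:
  assumes "Q \<in> class_Q" "0 < t"
  shows "0 < Q t"
proof -
  have "Q t \<noteq> 0"
  proof
    assume "Q t = 0"
    then have "(\<lambda>k::nat. t) \<longlonglongrightarrow> 0"
      using assms unfolding class_Q_def by (auto dest!: spec[of _ "\<lambda>_. t"])
    with \<open>0 < t\<close> show False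
      by (simp add: LIMSEQ_const_iff)
  qed
  then show ?thesis
    using class_Q_nonneg[OF assms(1), of t] assms(2) by simp
qed

text \<open>Monotonicity and positivity of \<open>Q\<close> extend the sequence condition to
  sequences that may take the value 0.\<close>

lemma class_Q_tendsto_0D:
  assumes Q: "Q \<in> class_Q" and t: "\<And>n::nat. 0 \<le> t n" and lim: "(\<lambda>n. Q (t n)) \<longlonglongrightarrow> 0"
  shows "t \<longlonglongrightarrow> 0"
proof (rule order_tendstoI)
  fix e :: real assume "0 < e"
  then have "\<forall>\<^sub>F n in sequentially. Q (t n) < Q e"
    by (intro order_tendstoD[OF lim] class_Q_pos[OF Q])
  then show "\<forall>\<^sub>F n in sequentially. t n < e"
  proof eventually_elim
    case (elim n)
    show ?case
    proof (rule ccontr)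
      assume "\<not> t n < e"
      then have "Q e \<le> Q (t n)"
        using Q \<open>0 < e\<close> by (auto simp: class_Q_def intro: mono_onD)
      with elim show False by simp
    qed
  qed
qed (use t in \<open>auto intro!: always_eventually intro: order_less_le_trans\<close>)

text \<open>Monotonicity of \<delta> bounds \<open>b n\<close> by the iterate
  \<open>(\<delta> ^^ n) (b 0)\<close>, whose limit is given for positive starting points.\<close>

lemma class_Delta_iterates_tendsto_0:
  assumes \<delta>: "\<delta> \<in> class_Delta" and b: "\<And>n::nat. 0 \<le> b n" "\<And>n. b (Suc n) \<le> \<delta> (b n)" and "0 < b 0"
  shows "b \<longlonglongrightarrow> 0"
proof -
  have \<delta>': "0 \<le> \<delta> x" "x \<le> y \<Longrightarrow> \<delta> x \<le> \<delta> y" if "0 \<le> x" for x y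
    using \<delta> that by (auto simp: class_Delta_def Pi_iff intro: mono_onD)
  have le: "b n \<le> (\<delta> ^^ n) (b 0)" for n
  proof (induction n)
    case (Suc n)
    then show ?case
      using b(2)[of n] \<delta>'(2)[OF b(1) Suc] by simp
  qed simp
  have "(\<lambda>n. (\<delta> ^^ n) (b 0)) \<longlonglongrightarrow> 0"
    using \<delta> \<open>0 < b 0\<close> by (simp add: class_Delta_def)
  then show ?thesis
    by (rule tendsto_sandwich[rotated -1]) (use b le in auto)
qed

section \<open>Coupled fixed points on a compact convex set and its construction by iterated
  hulls\<close>

theorem coupled_fixed_point:
  fixes K :: "'a::real_normed_vector set"
  assumes K: "compact K" "convex K" "K \<noteq> {}"
    and \<Psi>: "continuous_on (K \<times> K) \<Psi>" "\<Psi> \<in> K \<times> K \<rightarrow> K"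
  shows "\<exists>u\<in>K. \<exists>v\<in>K. \<Psi> (u, v) = u \<and> \<Psi> (v, u) = v"
proof -
  define G where "G z = (\<Psi> (fst z, snd z), \<Psi> (snd z, fst z))" for z
  have "continuous_on (K \<times> K) G"
    unfolding G_def by (intro continuous_intros continuous_on_compose2[OF \<Psi>(1)]) auto
  moreover have "G \<in> K \<times> K \<rightarrow> K \<times> K"
    using \<Psi>(2) by (auto simp: G_def)
  ultimately obtain z where "z \<in> K \<times> K" "G z = z"
    using schauder[of "K \<times> K" G] K by (auto simp: compact_Times convex_Times)
  then show ?thesis
    by (cases z) (auto simp: G_def)
qed

theorem theorem3p4:
  fixes C :: "'a::banach set"
    and \<mu> :: "'a set \<Rightarrow> real"
    and Q \<delta> F :: "real \<Rightarrow> real"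
    and E :: "real \<times> real \<Rightarrow> real"
    and \<Psi> :: "'a \<times> 'a \<Rightarrow> 'a"
  assumes "C \<noteq> {}" and "bounded C" and "closed C" and "convex C"
    and "measure_of_noncompactness \<mu>"
    and "Q \<in> class_Q" and "\<delta> \<in> class_Delta" and "E \<in> class_E"
    and "F \<in> {0..} \<rightarrow> {0..}" and "mono_on {0..} F" and "continuous_on {0..} F"
    and "\<And>a b. 0 \<le> a \<Longrightarrow> 0 \<le> b \<Longrightarrow> Q (a + b) \<le> Q a + Q b"
    and "\<And>a b. 0 \<le> a \<Longrightarrow> 0 \<le> b \<Longrightarrow> F (a + b) \<le> F a + F b"
    and "\<Psi> \<in> C \<times> C \<rightarrow> C" and "continuous_on (C \<times> C) \<Psi>"
    and "\<And>s1 s2. s1 \<noteq> {} \<Longrightarrow> s2 \<noteq> {} \<Longrightarrow> s1 \<subseteq> C \<Longrightarrow> s2 \<subseteq> C \<Longrightarrow>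
      Q (E (\<mu> (\<Psi> ` (s1 \<times> s2)), F (\<mu> (\<Psi> ` (s1 \<times> s2)))))
        \<le> 1 / 2 * \<delta> (Q (E (\<mu> s1, F (\<mu> s1)) + E (\<mu> s2, F (\<mu> s2))))"
  shows "\<exists>u\<in>C. \<exists>v\<in>C. \<Psi> (u, v) = u \<and> \<Psi> (v, u) = v"
proof -
  note C = assms(1-4) and Q = \<open>Q \<in> class_Q\<close> and \<delta> = \<open>\<delta> \<in> class_Delta\<close>
    and Q_add = assms(12) and \<Psi> = assms(14,15) and contraction = assms(16)
  have mnc_nonneg: "0 \<le> \<mu> A" if "A \<in> bounded_sets" for A
    using assms(5) that by (simp add: measure_of_noncompactness_def)
  have mnc_compact: "compact (closure A)" if "A \<in> bounded_sets" "\<mu> A = 0" for A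
    using assms(5) that by (simp add: measure_of_noncompactness_def relatively_compact_def)
  have mnc_mono: "\<mu> A \<le> \<mu> B" if "A \<in> bounded_sets" "B \<in> bounded_sets" "A \<subseteq> B" for A B
    using assms(5) that by (simp add: measure_of_noncompactness_def)
  have mnc_hull: "\<mu> (closure (convex hull A)) = \<mu> A" if "A \<in> bounded_sets" for A
    using assms(5) that by (simp add: measure_of_noncompactness_def)
  have mnc_Inter: "(\<Inter>q. A q) \<noteq> {}"
    if "\<And>q. A q \<in> bounded_sets" "\<And>q. closed (A q)" "\<And>q. A (Suc q) \<subseteq> A q" "(\<lambda>q. \<mu> (A q)) \<longlonglongrightarrow> 0"
    for A :: "nat \<Rightarrow> 'a set"
    using assms(5) that unfolding measure_of_noncompactness_def by (simp add: closure_closed)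

  \<comment> \<open>The closed convex hull makes every \<open>X n\<close> closed and convex and
    leaves the measure of the image unchanged, so the contraction condition still applies.\<close>
  define X where "X n = ((\<lambda>A. closure (convex hull (\<Psi> ` (A \<times> A)))) ^^ n) C" for n
  have X_0: "X 0 = C" and X_Suc: "X (Suc n) = closure (convex hull (\<Psi> ` (X n \<times> X n)))" for n
    by (simp_all add: X_def)
  have X_decr: "X (Suc n) \<subseteq> X n" for n
  proof (induction n)
    case 0
    have "convex hull (\<Psi> ` (C \<times> C)) \<subseteq> C"
      using \<Psi>(1) C(4) by (intro hull_minimal) auto
    then show ?case
      using C(3) by (simp add: X_0 X_Suc closure_minimal)
  next
    case (Suc n)
    then show ?case
      unfolding X_Suc[of "Suc n"] X_Suc[of n]
      by (intro closure_mono hull_mono image_mono Sigma_mono)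
  qed
  have X_C: "X n \<subseteq> C" for n
    using lift_Suc_antimono_le[of X 0 n] X_decr X_0 by auto
  have X_ne: "X n \<noteq> {}" for n
    by (induction n) (use C(1) in \<open>auto simp: X_0 X_Suc\<close>)
  have X_convex: "convex (X n)" and X_closed: "closed (X n)" for n
    by (cases n; use C in \<open>simp add: X_0 X_Suc convex_closure\<close>)+
  have sub_bounded: "A \<in> bounded_sets" if "A \<noteq> {}" "A \<subseteq> C" for A
    using that C(2) by (auto simp: bounded_sets_def intro: bounded_subset)
  have \<Psi>_X: "\<Psi> ` (X n \<times> X n) \<in> bounded_sets" for n
    using X_ne[of n] X_C[of n] \<Psi>(1) by (intro sub_bounded) auto
  have X_bdd: "X n \<in> bounded_sets" for n
    by (rule sub_bounded[OF X_ne X_C])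

  define e where "e n = E (\<mu> (X n), F (\<mu> (X n)))" for n
  have e_ge: "\<mu> (X n) \<le> e n" for n
  proof -
    have "0 \<le> F (\<mu> (X n))"
      using assms(9) mnc_nonneg[OF X_bdd] by auto
    then have "max (\<mu> (X n)) (F (\<mu> (X n))) \<le> e n"
      using \<open>E \<in> class_E\<close> mnc_nonneg[OF X_bdd] by (simp add: class_E_def e_def)
    then show ?thesis by simp
  qed
  then have e_nonneg: "0 \<le> e n" for n
    using mnc_nonneg[OF X_bdd] order_trans by blast
  have step: "2 * Q (e (Suc n)) \<le> \<delta> (2 * Q (e n))" for n
  proof -
    \<comment> \<open>Both sets in the condition are \<open>X n\<close>. Tracking
      \<open>2 * Q (e n)\<close> absorbs the factor 1/2 together with the doubled argument.\<close>
    have "2 * Q (e (Suc n)) \<le> \<delta> (Q (e n + e n))"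
      using contraction[OF X_ne X_ne X_C X_C, of n n] mnc_hull[OF \<Psi>_X, of n]
      by (simp add: e_def X_Suc)
    also have "\<dots> \<le> \<delta> (2 * Q (e n))"
      using \<delta> Q_add[OF e_nonneg e_nonneg, of n n] class_Q_nonneg[OF Q, of "e n + e n"] e_nonneg[of n]
      by (auto simp: class_Delta_def intro!: mono_onD[of _ \<delta>])
    finally show ?thesis .
  qed
  have mnc_X_lim: "(\<lambda>n. \<mu> (X n)) \<longlonglongrightarrow> 0"
  \<comment> \<open>The iteration lemma starts from a positive value. If \<open>e 0 = 0\<close>,
    then \<open>C\<close> and all its nonempty subsets have measure 0.\<close>
  proof (cases "e 0 = 0")
    case True
    have "\<mu> (X n) = 0" for n
      using mnc_mono[OF X_bdd X_bdd, of n 0] X_C[of n] e_ge[of 0] True mnc_nonneg[OF X_bdd, of n]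
      by (simp add: X_0)
    then show ?thesis by simp
  next
    case False
    then have "0 < 2 * Q (e 0)"
      using class_Q_pos[OF Q] e_nonneg[of 0] by simp
    then have "(\<lambda>n. 2 * Q (e n)) \<longlonglongrightarrow> 0"
      using class_Q_nonneg[OF Q e_nonneg] step by (intro class_Delta_iterates_tendsto_0[OF \<delta>]) auto
    then have "(\<lambda>n. Q (e n)) \<longlonglongrightarrow> 0"
      using tendsto_mult_left[of "\<lambda>n. 2 * Q (e n)" 0 sequentially "1/2"] by simp
    then have "e \<longlonglongrightarrow> 0"
      by (rule class_Q_tendsto_0D[OF Q e_nonneg])
    then show ?thesis
      by (rule tendsto_sandwich[rotated -1]) (use e_ge mnc_nonneg[OF X_bdd] in auto)
  qed

  define K where "K = (\<Inter>n. X n)"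
  have K_ne: "K \<noteq> {}"
    unfolding K_def by (rule mnc_Inter[OF X_bdd X_closed X_decr mnc_X_lim])
  have K_C: "K \<subseteq> C"
    using X_C by (auto simp: K_def)
  then have K_bdd: "K \<in> bounded_sets"
    using K_ne by (rule sub_bounded[rotated])
  \<comment> \<open>\<open>K\<close> lies in every \<open>X n\<close>, so its measure is below each
    term of a null sequence; being closed, \<open>K\<close> is then compact.\<close>
  have "\<mu> K \<le> 0"
    by (rule LIMSEQ_le_const[OF mnc_X_lim]) (auto simp: K_def intro!: mnc_mono X_bdd K_bdd[unfolded K_def])
  then have "compact (closure K)"
    using mnc_compact[OF K_bdd] mnc_nonneg[OF K_bdd] by simp
  then have "compact K"
    using X_closed by (simp add: K_def closed_INT)
  moreover have "convex K"
    using X_convex by (auto simp: K_def intro: convex_INT)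
  moreover have "continuous_on (K \<times> K) \<Psi>"
    using K_C by (intro continuous_on_subset[OF \<Psi>(2)]) auto
  moreover have "\<Psi> \<in> K \<times> K \<rightarrow> K"
  proof (rule funcsetI)
    fix z assume z: "z \<in> K \<times> K"
    \<comment> \<open>Images are controlled one index later; \<open>X_decr\<close> then brings them
      back to every \<open>X n\<close>, including \<open>X 0\<close>.\<close>
    have "\<Psi> z \<in> X (Suc n)" for n
      using z unfolding X_Suc by (intro subsetD[OF closure_subset] hull_inc) (auto simp: K_def)
    then show "\<Psi> z \<in> K"
      using X_decr by (auto simp: K_def)
  qed
  ultimately show ?thesis
    using coupled_fixed_point[of K \<Psi>] K_ne K_C by blast
qed

end
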